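(* For a Tychonoff space $X$, the following assertions (a) and (b) are equivalent: (a) $X$ is a $k_{\mathbb{R}}$-space; (b) there is a cover $\mathcal{M}$ of $X$ consisting of subspaces of $X$ which are $k_{\mathbb{R}}$-spaces and having (at least) one of the following properties: (i) for every subset $A$ of $X$ and each point $x\in\overline{A}$, there is $B\in\mathcal{M}$ such that $x\in B\cap\overline{A\cap B}$; (ii) for every non-closed subset $Q$ of $X$, there are a point $x\in\overline{Q}\setminus Q$ and an $M\in\mathcal{M}$ such that $x\in M\cap\overline{Q\cap M}$; (iii) $M$ is $k$-dense in $X$ for each $M\in\mathcal{M}$; (iv) $M\cap M'$ is dense in $X$ for all $M,M'\in\mathcal{M}$; (v) $M$ is $k_{\mathbb{R}}$-dense in $X$ for each $M\in\mathcal{M}$; (vi) $\mathcal{M}$ is locally finite and all $M\in\mathcal{M}$ are closed.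
   Context: All spaces are assumed to be Tychonoff. A function $f:X\to\mathbb{R}$ is $k$-continuous if its restriction to every compact subset of $X$ is continuous. A space $X$ is a $k_{\mathbb{R}}$-space if every $k$-continuous function $f:X\to\mathbb{R}$ is continuous. For a cover $\mathcal{N}$ of $X$, a subset $A\subseteq X$ is $\mathcal{N}$-dense if for every $x\in X$ there is $N\in\mathcal{N}$ such that $x\in N\cap\overline{N\cap A}$. A subset $L\subseteq X$ is $k$-dense in $X$ if it is $\mathcal{N}$-dense for $\mathcal{N}$ the family of all compact subsets of $X$, and $k_{\mathbb{R}}$-dense in $X$ if it is $\mathcal{N}$-dense for $\mathcal{N}$ the family of all subspaces of $X$ which are $k_{\mathbb{R}}$-spaces. Closures are taken in $X$. *)

theory Defs
  imports "HOL-Analysis.Analysis"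
begin

definition Tychonoff_space :: "'a topology \<Rightarrow> bool" where
  "Tychonoff_space X \<longleftrightarrow> completely_regular_space X \<and> Hausdorff_space X"

text \<open>
  Functions on a space are total functions on the underlying type; their values outside
  \<^term>\<open>topspace X\<close> are irrelevant.
\<close>

definition k_continuous_map :: "'a topology \<Rightarrow> ('a \<Rightarrow> real) \<Rightarrow> bool" where
  "k_continuous_map X f \<longleftrightarrow>
     (\<forall>K. compactin X K \<longrightarrow> continuous_map (subtopology X K) euclideanreal f)"

definition kR_space :: "'a topology \<Rightarrow> bool" where
  "kR_space X \<longleftrightarrow> (\<forall>f. k_continuous_map X f \<longrightarrow> continuous_map X euclideanreal f)"

definition cover_of :: "'a topology \<Rightarrow> 'a set set \<Rightarrow> bool" where
  "cover_of X \<N> \<longleftrightarrow> \<Union>\<N> = topspace X"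

definition family_dense_in :: "'a topology \<Rightarrow> 'a set set \<Rightarrow> 'a set \<Rightarrow> bool" where
  "family_dense_in X \<N> A \<longleftrightarrow>
     A \<subseteq> topspace X \<and>
     (\<forall>x\<in>topspace X. \<exists>N\<in>\<N>. x \<in> N \<inter> X closure_of (N \<inter> A))"

definition k_dense_in :: "'a topology \<Rightarrow> 'a set \<Rightarrow> bool" where
  "k_dense_in X L \<longleftrightarrow> family_dense_in X {K. compactin X K} L"

definition kR_dense_in :: "'a topology \<Rightarrow> 'a set \<Rightarrow> bool" where
  "kR_dense_in X L \<longleftrightarrow>
     family_dense_in X {N. N \<subseteq> topspace X \<and> kR_space (subtopology X N)} L"

end

theory Submission
  imports Defs
begin

text \<open>
  A \<open>k\<close>-continuous function \<open>f\<close> is continuous on every \<open>k\<^sub>\<real>\<close>-subspace, so the task is to glue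
  the restrictions of \<open>f\<close> to the members of the cover. Property (vi) implies (i), since the closure
  of a locally finite union is the union of the closures, and (i) implies (ii); under (ii) preimages
  of closed sets are closed. Properties (iii) and (iv) both imply (v). Under (v), if \<open>f\<close> is close to
  \<open>f x\<close> on \<open>U \<inter> M\<close> with \<open>x \<in> M\<close> and \<open>U\<close> open, then for any \<open>z \<in> U\<close> there is a
  \<open>k\<^sub>\<real>\<close>-subspace \<open>N\<close> containing \<open>z\<close> in which \<open>z\<close> is adherent to \<open>U \<inter> M\<close>, and continuity of \<open>f\<close>
  on \<open>N\<close> carries the estimate over to \<open>z\<close>.
\<close>

text \<open>\<open>K\<close> is one of the compact subsets on which \<open>k\<close>-continuity is
  tested, and it fills the whole subspace. Compact sets are thus among the test sets of
  \<open>kR_dense_in\<close>, which links (iii) to (v).\<close>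

lemma compactin_imp_kR_space:
  assumes "compactin X K"
  shows "kR_space (subtopology X K)"
  unfolding kR_space_def
proof (intro allI impI)
  fix f assume "k_continuous_map (subtopology X K) f"
  moreover have "compactin (subtopology X K) K"
    using assms by (simp add: compactin_subtopology)
  ultimately show "continuous_map (subtopology X K) euclideanreal f"
    unfolding k_continuous_map_def by (metis inf.idem subtopology_subtopology)
qed

lemma k_continuous_map_subtopology:
  assumes "k_continuous_map X f"
  shows "k_continuous_map (subtopology X N) f"
  using assms unfolding k_continuous_map_def
  by (auto simp: compactin_subtopology subtopology_subtopology Int_absorb1)

lemma k_continuous_map_on_kR_subspace:
  assumes "k_continuous_map X f" "kR_space (subtopology X N)"
  shows "continuous_map (subtopology X N) euclideanreal f"
  using assms k_continuous_map_subtopology unfolding kR_space_def by blast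

text \<open>Both gluing arguments rest on this transfer: the adherence is measured in
  \<open>X\<close>, but since \<open>x\<close> and the approximating points lie in \<open>N\<close>,
  it also holds in the subspace, where \<open>f\<close> is continuous.\<close>

lemma closure_of_value_in_closed:
  assumes f: "continuous_map (subtopology X N) euclideanreal f"
    and x: "x \<in> N" "x \<in> X closure_of (N \<inter> A)"
    and C: "closed C" "f ` (N \<inter> A) \<subseteq> C"
  shows "f x \<in> C"
proof -
  have "x \<in> subtopology X N closure_of (N \<inter> A)"
    using x by (simp add: closure_of_subtopology)
  then have "f x \<in> euclideanreal closure_of (f ` (N \<inter> A))"
    using f by (meson continuous_map_image_closure_subset image_subset_iff)
  also have "euclideanreal closure_of (f ` (N \<inter> A)) \<subseteq> C"
    using C by (simp add: closure_minimal)
  finally show ?thesis .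
qed

lemma continuous_map_if_nonclosed_detected:
  fixes f :: "'a \<Rightarrow> real"
  assumes f: "\<And>M. M \<in> \<M> \<Longrightarrow> continuous_map (subtopology X M) euclideanreal f"
    and ii: "\<And>Q. \<lbrakk>Q \<subseteq> topspace X; \<not> closedin X Q\<rbrakk> \<Longrightarrow>
           \<exists>x\<in>X closure_of Q - Q. \<exists>M\<in>\<M>. x \<in> M \<inter> X closure_of (Q \<inter> M)"
  shows "continuous_map X euclideanreal f"
  unfolding continuous_map_closedin
proof (intro conjI allI impI)
  fix C :: "real set" assume "closedin euclideanreal C"
  then have C: "closed C" by simp
  let ?Q = "{x \<in> topspace X. f x \<in> C}"
  show "closedin X ?Q"
  proof (rule ccontr)
    assume "\<not> closedin X ?Q"
    then obtain x M where x: "x \<in> X closure_of ?Q" "x \<notin> ?Q"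
      and M: "M \<in> \<M>" "x \<in> M" "x \<in> X closure_of (M \<inter> ?Q)"
      using ii[of ?Q] by (auto simp: Int_commute)
    have "f x \<in> C"
      by (rule closure_of_value_in_closed[OF f[OF M(1)] M(2,3) C]) auto
    \<comment> \<open>Adherent points lie in \<open>topspace X\<close>, so \<open>x\<close> can be
      missing from \<open>?Q\<close> only if \<open>f x\<close> is outside \<open>C\<close>.\<close>
    with x show False
      using closure_of_subset_topspace by fastforce
  qed
qed auto

lemma continuous_map_if_kR_dense_cover:
  assumes f: "k_continuous_map X f" and cov: "cover_of X \<M>"
    and kR: "\<And>M. M \<in> \<M> \<Longrightarrow> kR_space (subtopology X M)"
    and dense: "\<And>M. M \<in> \<M> \<Longrightarrow> kR_dense_in X M"
  shows "continuous_map X euclideanreal f"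
proof -
  have "\<exists>U. openin X U \<and> x \<in> U \<and> (\<forall>z\<in>U. f z \<in> ball (f x) e)"
    if x: "x \<in> topspace X" and e: "e > 0" for x e
  proof -
    obtain M where M: "M \<in> \<M>" "x \<in> M"
      using cov x unfolding cover_of_def by blast
    have "continuous_map (subtopology X M) euclideanreal f"
      using k_continuous_map_on_kR_subspace[OF f kR] M by blast
    \<comment> \<open>Half the radius leaves room for passing to a closed ball later:
      \<open>cball (f x) (e/2)\<close> is still inside \<open>ball (f x) e\<close>.\<close>
    then have "openin (subtopology X M) {y \<in> topspace (subtopology X M). f y \<in> ball (f x) (e/2)}"
      by (rule openin_continuous_map_preimage) simp
    then obtain U where U: "openin X U"
      and U_eq: "{y \<in> topspace (subtopology X M). f y \<in> ball (f x) (e/2)} = U \<inter> M"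
      unfolding openin_subtopology by metis
    have "x \<in> {y \<in> topspace (subtopology X M). f y \<in> ball (f x) (e/2)}"
      using M x e by simp
    then have "x \<in> U" unfolding U_eq by blast
    moreover have "f z \<in> ball (f x) e" if z: "z \<in> U" for z
    proof -
      have "z \<in> topspace X" using U z openin_subset by blast
      then obtain N where N: "kR_space (subtopology X N)" "z \<in> N" "z \<in> X closure_of (N \<inter> M)"
        using dense[OF M(1)] unfolding kR_dense_in_def family_dense_in_def by blast
      \<comment> \<open>\<open>U\<close> is an open neighbourhood of \<open>z\<close>, so
        \<open>z\<close> remains adherent when \<open>N \<inter> M\<close> is cut down to
        \<open>U\<close>.\<close>
      then have "z \<in> X closure_of (N \<inter> (U \<inter> M))"
        using openin_Int_closure_of_subset[OF U, of "N \<inter> M"] z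
        by (metis IntI inf_left_commute subsetD)
      moreover have "f ` (N \<inter> (U \<inter> M)) \<subseteq> cball (f x) (e/2)"
        unfolding U_eq[symmetric] by auto
      ultimately have "f z \<in> cball (f x) (e/2)"
        using closure_of_value_in_closed[OF k_continuous_map_on_kR_subspace[OF f N(1)] N(2)]
        by (metis closed_cball)
      then show ?thesis using e by auto
    qed
    ultimately show ?thesis using U by blast
  qed
  then show ?thesis
    using Met_TC.continuous_map_to_metric[of X f] by simp
qed

text \<open>The traces of the cover on \<open>A\<close> are again locally finite and have union
  \<open>A\<close>, so an adherent point of \<open>A\<close> is adherent to one of them.\<close>

lemma closure_of_locally_finite_cover:
  assumes lf: "locally_finite_in X \<M>" and cov: "cover_of X \<M>"
    and A: "A \<subseteq> topspace X" "x \<in> X closure_of A"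
  obtains M where "M \<in> \<M>" "x \<in> X closure_of (A \<inter> M)"
proof -
  have "locally_finite_in X ((\<inter>) A ` \<M>)"
    by (rule locally_finite_in_refinement[OF lf]) auto
  then have "X closure_of (\<Union>((\<inter>) A ` \<M>)) = \<Union>((closure_of) X ` (\<inter>) A ` \<M>)"
    by (rule closure_of_locally_finite_Union)
  moreover have "\<Union>((\<inter>) A ` \<M>) = A"
    using cov A(1) unfolding cover_of_def by blast
  ultimately show thesis using A(2) that by auto
qed

text \<open>The test set at \<open>x\<close> is simply a member of the cover containing
  \<open>x\<close>; its trace on \<open>M\<close> is dense in all of \<open>X\<close>, hence
  adherent to \<open>x\<close>.\<close>

lemma dense_imp_kR_dense:
  assumes cov: "cover_of X \<M>" and kR: "\<And>M. M \<in> \<M> \<Longrightarrow> kR_space (subtopology X M)"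
    and d: "\<And>M'. M' \<in> \<M> \<Longrightarrow> X closure_of (M' \<inter> M) = topspace X" and M: "M \<in> \<M>"
  shows "kR_dense_in X M"
  unfolding kR_dense_in_def family_dense_in_def
proof (intro conjI ballI)
  show "M \<subseteq> topspace X" using cov M unfolding cover_of_def by blast
  fix x assume x: "x \<in> topspace X"
  then obtain N where "N \<in> \<M>" "x \<in> N" using cov unfolding cover_of_def by blast
  then show "\<exists>N\<in>{N. N \<subseteq> topspace X \<and> kR_space (subtopology X N)}. x \<in> N \<inter> X closure_of (N \<inter> M)"
    using cov kR d x unfolding cover_of_def by blast
qed

lemma k_dense_imp_kR_dense: "k_dense_in X M \<Longrightarrow> kR_dense_in X M"
  unfolding k_dense_in_def kR_dense_in_def family_dense_in_def
  using compactin_imp_kR_space compactin_subset_topspace by blast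

theorem theorem6p3:
  fixes X :: "'a topology"
  assumes "Tychonoff_space X"
  shows "kR_space X \<longleftrightarrow>
    (\<exists>\<M>. cover_of X \<M> \<and> (\<forall>M\<in>\<M>. kR_space (subtopology X M)) \<and>
      ((\<forall>A x. A \<subseteq> topspace X \<and> x \<in> X closure_of A \<longrightarrow>
           (\<exists>B\<in>\<M>. x \<in> B \<inter> X closure_of (A \<inter> B)))
       \<or> (\<forall>Q. Q \<subseteq> topspace X \<and> \<not> closedin X Q \<longrightarrow>
           (\<exists>x\<in>X closure_of Q - Q. \<exists>M\<in>\<M>. x \<in> M \<inter> X closure_of (Q \<inter> M)))
       \<or> (\<forall>M\<in>\<M>. k_dense_in X M)
       \<or> (\<forall>M\<in>\<M>. \<forall>M'\<in>\<M>. X closure_of (M \<inter> M') = topspace X)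
       \<or> (\<forall>M\<in>\<M>. kR_dense_in X M)
       \<or> (locally_finite_in X \<M> \<and> (\<forall>M\<in>\<M>. closedin X M))))"
    (is "_ \<longleftrightarrow> (\<exists>\<M>. _ \<and> _ \<and> (?i \<M> \<or> ?ii \<M> \<or> ?iii \<M> \<or> ?iv \<M> \<or> ?v \<M> \<or> ?vi \<M>))")
proof
  assume "kR_space X"
  \<comment> \<open>The trivial cover by the whole space satisfies (i).\<close>
  then have "cover_of X {topspace X}" "\<forall>M\<in>{topspace X}. kR_space (subtopology X M)"
    by (simp_all add: cover_of_def)
  moreover have "?i {topspace X}"
    by (simp add: Int_absorb2 in_closure_of)
  ultimately show "\<exists>\<M>. cover_of X \<M> \<and> (\<forall>M\<in>\<M>. kR_space (subtopology X M)) \<and>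
      (?i \<M> \<or> ?ii \<M> \<or> ?iii \<M> \<or> ?iv \<M> \<or> ?v \<M> \<or> ?vi \<M>)"
    by (intro exI[of _ "{topspace X}"] conjI disjI1)
next
  assume "\<exists>\<M>. cover_of X \<M> \<and> (\<forall>M\<in>\<M>. kR_space (subtopology X M)) \<and>
      (?i \<M> \<or> ?ii \<M> \<or> ?iii \<M> \<or> ?iv \<M> \<or> ?v \<M> \<or> ?vi \<M>)"
  then obtain \<M> where cov: "cover_of X \<M>" and kR: "\<And>M. M \<in> \<M> \<Longrightarrow> kR_space (subtopology X M)"
    and alt: "?i \<M> \<or> ?ii \<M> \<or> ?iii \<M> \<or> ?iv \<M> \<or> ?v \<M> \<or> ?vi \<M>"
    by (elim exE conjE) (rule that, assumption, erule bspec)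
  have vi_i: "?i \<M>" if "?vi \<M>"
  proof (intro allI impI, elim conjE)
    fix A x assume "A \<subseteq> topspace X" "x \<in> X closure_of A"
    then obtain M where M: "M \<in> \<M>" "x \<in> X closure_of (A \<inter> M)"
      using closure_of_locally_finite_cover cov \<open>?vi \<M>\<close> by metis
    \<comment> \<open>Here closedness of the members enters: \<open>M\<close> contains the closure
      of \<open>A \<inter> M\<close>.\<close>
    then have "x \<in> M"
      using closure_of_minimal[of "A \<inter> M" M X] \<open>?vi \<M>\<close> by blast
    with M show "\<exists>B\<in>\<M>. x \<in> B \<inter> X closure_of (A \<inter> B)" by blast
  qed
  have i_ii: "?ii \<M>" if "?i \<M>"
  proof (intro allI impI, elim conjE)
    fix Q assume Q: "Q \<subseteq> topspace X" "\<not> closedin X Q"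
    then obtain x where x: "x \<in> X closure_of Q" "x \<notin> Q"
      by (metis closure_of_subset_eq subsetI)
    with Q \<open>?i \<M>\<close>
    show "\<exists>x\<in>X closure_of Q - Q. \<exists>M\<in>\<M>. x \<in> M \<inter> X closure_of (Q \<inter> M)" by blast
  qed
  have iii_v: "?v \<M>" if "?iii \<M>"
    using that k_dense_imp_kR_dense by blast
  have iv_v: "?v \<M>" if "?iv \<M>"
    using that dense_imp_kR_dense[OF cov kR] by blast
  have "?ii \<M> \<or> ?v \<M>"
    using alt
  proof (elim disjE)
    show ?thesis if "?i \<M>" by (rule disjI1, rule i_ii, rule that)
    show ?thesis if "?ii \<M>" by (rule disjI1, rule that)
    show ?thesis if "?iii \<M>" by (rule disjI2, rule iii_v, rule that)
    show ?thesis if "?iv \<M>" by (rule disjI2, rule iv_v, rule that)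
    show ?thesis if "?v \<M>" by (rule disjI2, rule that)
    show ?thesis if "?vi \<M>" by (rule disjI1, rule i_ii, rule vi_i, rule that)
  qed
  then show "kR_space X"
  proof
    assume ii: "?ii \<M>"
    have "continuous_map X euclideanreal f" if "k_continuous_map X f" for f
      by (rule continuous_map_if_nonclosed_detected[OF k_continuous_map_on_kR_subspace[OF that kR]],
          assumption) (rule ii[rule_format], rule conjI)
    then show ?thesis unfolding kR_space_def by blast
  next
    assume v: "?v \<M>"
    have "continuous_map X euclideanreal f" if "k_continuous_map X f" for f
      by (rule continuous_map_if_kR_dense_cover[OF that cov kR v[rule_format]])
    then show ?thesis unfolding kR_space_def by blast
  qed
qed

end
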